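(* For the Generalized Multiple Strip Packing Problem with makespan objective, neither of the two lower bounds $Z^{\mathrm{ms}}$ and LP-PC dominates the other. Specifically: (a) for the instance with a single strip of width $10$, one item of width $1$ and height $10$, and nine items of width $1$ and height $1$, one has $Z^{\mathrm{ms}}=1.9$ while the optimal value of LP-PC is at least $10$; (b) for the instance with two strips of width $10$ and a single item of width $10$ and height $10$ (the same dimensions on both strips), one has $Z^{\mathrm{ms}}=10$ while the optimal value of LP-PC equals $5$.
   Context: **Instance.** Items $\mathcal J=\{1,\dots,n\}$, strips $\mathcal I=\{1,\dots,m\}$; strip $i$ has positive integer width $W_i$ and infinite height. Item $j$, if assigned to strip $i$, is a rectangle of positive integer width $w_{ij}$ and positive integer height $h_{ij}$. Item $j$ may be packed in strip $i$ only if $w_{ij}\le W_i$ (then the pair $(i,j)$ is called eligible); every item is eligible for at least one strip. In the problem, each item is packed exactly once in some strip, without overlap and without rotation, and with makespan objective one minimizes $\max_iH_i$, where $H_i\ge0$ is the height of strip $i$. **Scheduling bound.** With $s_{ij}=w_{ij}h_{ij}/W_i$, $$Z^{\mathrm{ms}}=\min\Bigl\{H:\ \sum_{j}s_{ij}v_{ij}\le H\ \forall i,\ \ \sum_iv_{ij}=1\ \forall j,\ \ v_{ij}\in\{0,1\},\ \ v_{ij}=0\text{ if }w_{ij}>W_i\Bigr\}.$$ **Normal positions.** For an eligible pair $(i,j)$, $\mathcal W_i(j)$ is the set of $p\in\{0,\dots,W_i-w_{ij}\}$ that can be written as $\sum_{k\in S}w_{ik}$ for some subset $S\subseteq\mathcal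 J\setminus\{j\}$ (the empty sum $0$ is allowed); for non-eligible pairs $\mathcal W_i(j)=\emptyset$. For $q\in\{0,\dots,W_i-1\}$, $\mathcal W_i(j,q)=\{p\in\mathcal W_i(j): p\le q\le p+w_{ij}-1\}$. **LP-PC (makespan).** LP-PC is the linear program with variables $0\le x_{ijp}\le 1$ ($i\in\mathcal I$, $j\in\mathcal J$, $p\in\mathcal W_i(j)$), $H_i\ge 0$ and $H^{\max}$, minimizing $H^{\max}$ subject to - $H^{\max}\ge H_i$ for all $i\in\mathcal I$; - $\sum_{i}\sum_{p\in\mathcal W_i(j)}x_{ijp}=1$ for all $j\in\mathcal J$; - $\sum_{j}\sum_{p\in\mathcal W_i(j,q)}h_{ij}x_{ijp}\le H_i$ for all $i\in\mathcal I$, $q\in\{0,\dots,W_i-1\}$; - $h_{ij}\sum_{p\in\mathcal W_i(j)}x_{ijp}\le H_i$ for all $i\in\mathcal I$, $j\in\mathcal J$. *)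

theory Defs
  imports Complex_Main
begin

record gmspp =
  num_items :: nat
  num_strips :: nat
  strip_width :: "nat \<Rightarrow> nat"
  item_width :: "nat \<Rightarrow> nat \<Rightarrow> nat"   (* strip, then item *)
  item_height :: "nat \<Rightarrow> nat \<Rightarrow> nat"  (* strip, then item *)

definition items :: "gmspp \<Rightarrow> nat set" where
  "items I = {1..num_items I}"

definition strips :: "gmspp \<Rightarrow> nat set" where
  "strips I = {1..num_strips I}"

definition eligible :: "gmspp \<Rightarrow> nat \<Rightarrow> nat \<Rightarrow> bool" where
  "eligible I i j \<longleftrightarrow> item_width I i j \<le> strip_width I i"

definition valid_instance :: "gmspp \<Rightarrow> bool" where
  "valid_instance I \<longleftrightarrow>
     num_items I \<ge> 1 \<and> num_strips I \<ge> 1 \<and>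
     (\<forall>i\<in>strips I. strip_width I i > 0) \<and>
     (\<forall>i\<in>strips I. \<forall>j\<in>items I. item_width I i j > 0 \<and> item_height I i j > 0) \<and>
     (\<forall>j\<in>items I. \<exists>i\<in>strips I. eligible I i j)"

definition sched_time :: "gmspp \<Rightarrow> nat \<Rightarrow> nat \<Rightarrow> real" where
  "sched_time I i j =
     real (item_width I i j) * real (item_height I i j) / real (strip_width I i)"

definition sched_feasible :: "gmspp \<Rightarrow> (nat \<Rightarrow> nat \<Rightarrow> real) \<Rightarrow> real \<Rightarrow> bool" where
  "sched_feasible I v H \<longleftrightarrow>
     (\<forall>i\<in>strips I. (\<Sum>j\<in>items I. sched_time I i j * v i j) \<le> H) \<and>
     (\<forall>j\<in>items I. (\<Sum>i\<in>strips I. v i j) = 1) \<and>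
     (\<forall>i\<in>strips I. \<forall>j\<in>items I. v i j \<in> {0, 1}) \<and>
     (\<forall>i\<in>strips I. \<forall>j\<in>items I. \<not> eligible I i j \<longrightarrow> v i j = 0)"

(* LEAST on the reals is the attained minimum (not merely the infimum); it is
   meaningful only when the minimum exists, as it does for every valid instance. *)
definition Z_ms :: "gmspp \<Rightarrow> real" where
  "Z_ms I = (LEAST H. \<exists>v. sched_feasible I v H)"

definition normal_positions :: "gmspp \<Rightarrow> nat \<Rightarrow> nat \<Rightarrow> nat set" where
  "normal_positions I i j =
     (if eligible I i j
      then {p \<in> {0..strip_width I i - item_width I i j}.
              \<exists>S \<subseteq> items I - {j}. p = (\<Sum>k\<in>S. item_width I i k)}
      else {})"

definition covering_positions :: "gmspp \<Rightarrow> nat \<Rightarrow> nat \<Rightarrow> nat \<Rightarrow> nat set" where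
  "covering_positions I i j q =
     {p \<in> normal_positions I i j. p \<le> q \<and> q \<le> p + item_width I i j - 1}"

definition lp_pc_feasible ::
  "gmspp \<Rightarrow> (nat \<Rightarrow> nat \<Rightarrow> nat \<Rightarrow> real) \<Rightarrow> (nat \<Rightarrow> real) \<Rightarrow> real \<Rightarrow> bool" where
  "lp_pc_feasible I x H Hmax \<longleftrightarrow>
     (\<forall>i\<in>strips I. \<forall>j\<in>items I. \<forall>p\<in>normal_positions I i j. 0 \<le> x i j p \<and> x i j p \<le> 1) \<and>
     (\<forall>i\<in>strips I. 0 \<le> H i) \<and>
     (\<forall>i\<in>strips I. H i \<le> Hmax) \<and>
     (\<forall>j\<in>items I. (\<Sum>i\<in>strips I. \<Sum>p\<in>normal_positions I i j. x i j p) = 1) \<and>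
     (\<forall>i\<in>strips I. \<forall>q\<in>{0..<strip_width I i}.
        (\<Sum>j\<in>items I. \<Sum>p\<in>covering_positions I i j q. real (item_height I i j) * x i j p) \<le> H i) \<and>
     (\<forall>i\<in>strips I. \<forall>j\<in>items I.
        real (item_height I i j) * (\<Sum>p\<in>normal_positions I i j. x i j p) \<le> H i)"

definition LP_PC :: "gmspp \<Rightarrow> real" where
  "LP_PC I = (LEAST Hmax. \<exists>x H. lp_pc_feasible I x H Hmax)"

definition dominates :: "(gmspp \<Rightarrow> real) \<Rightarrow> (gmspp \<Rightarrow> real) \<Rightarrow> bool" where
  "dominates A B \<longleftrightarrow> (\<forall>I. valid_instance I \<longrightarrow> A I \<ge> B I)"

definition instance_a :: gmspp where
  "instance_a =
     \<lparr>num_items = 10, num_strips = 1, strip_width = (\<lambda>_. 10),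
      item_width = (\<lambda>_ _. 1), item_height = (\<lambda>_ j. if j = 1 then 10 else 1)\<rparr>"

definition instance_b :: gmspp where
  "instance_b =
     \<lparr>num_items = 1, num_strips = 2, strip_width = (\<lambda>_. 10),
      item_width = (\<lambda>_ _. 10), item_height = (\<lambda>_ _. 10)\<rparr>"

lemma valid_instance_a: "valid_instance instance_a"
  by (auto simp: valid_instance_def instance_a_def strips_def items_def eligible_def)

lemma valid_instance_b: "valid_instance instance_b"
  by (auto simp: valid_instance_def instance_b_def strips_def items_def eligible_def)

end

theory Submission
  imports Defs
begin

text \<open>The two bounds relax different things, and each instance punishes one relaxation.
  \<open>Z_ms\<close> keeps the assignment integral but only compares areas, so a tall thin item is
  smeared over the whole width of its strip: in \<open>instance_a\<close> the area 10 + 9 on width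
  10 gives 1.9, whereas in LP-PC the item-height constraint of the tall item forces 10, there being
  no other strip to share it. LP-PC in turn lets an item be split between strips: in
  \<open>instance_b\<close> half of the item on each strip gives 5, whereas a binary assignment puts
  its whole area 100 on one strip of width 10. Both bounds are \<open>LEAST\<close> values, so each
  is evaluated by a feasible point together with a bound valid for every feasible point
  (\<open>Z_ms_instance_a\<close>, \<open>LP_PC_instance_a\<close>, \<open>Z_ms_instance_b\<close>,
  \<open>LP_PC_instance_b\<close>). This is why the value 10 must be shown attained even where only
  \<ge> 10 is claimed.\<close>

lemma items_a [simp]: "items instance_a = {1..10}"
  and strips_a [simp]: "strips instance_a = {1}"
  and items_b [simp]: "items instance_b = {1}"
  and strips_b [simp]: "strips instance_b = {1, 2}"
  by (auto simp: items_def strips_def instance_a_def instance_b_def)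

lemma Z_ms_instance_a: "Z_ms instance_a = 19 / 10"
proof -
  \<comment> \<open>With a single strip the assignment is forced, so every feasible point has this
    same load: 1 from the tall item and 1/10 from each of the other nine.\<close>
  have sum: "(\<Sum>j\<in>{1..10}. sched_time instance_a 1 j * v 1 j) = 19 / 10"
    if "\<forall>j\<in>{1..10}. v 1 j = 1" for v :: "nat \<Rightarrow> nat \<Rightarrow> real"
  proof -
    have "(\<Sum>j\<in>{1..10}. sched_time instance_a 1 j * v 1 j) =
        (\<Sum>j\<in>{1..10::nat}. if j = 1 then 1 else 1 / 10)"
      by (rule sum.cong) (use that in \<open>auto simp: sched_time_def instance_a_def\<close>)
    also have "\<dots> = 19 / 10"
      by (simp add: atLeastAtMost_upt numeral_eq_Suc)
    finally show ?thesis .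
  qed
  show ?thesis
    unfolding Z_ms_def
  proof (rule Least_equality)
    have "sched_feasible instance_a (\<lambda>_ _. 1) (19 / 10)"
      using sum[of "\<lambda>_ _. 1"]
      by (simp add: sched_feasible_def) (simp add: eligible_def instance_a_def)
    then show "\<exists>v. sched_feasible instance_a v (19 / 10)" by blast
  next
    fix H assume "\<exists>v. sched_feasible instance_a v H"
    then obtain v where "sched_feasible instance_a v H" ..
    then have "\<forall>j\<in>{1..10}. v 1 j = 1"
      and "(\<Sum>j\<in>{1..10}. sched_time instance_a 1 j * v 1 j) \<le> H"
      unfolding sched_feasible_def items_a strips_a by (simp, blast)
    with sum[of v] show "19 / 10 \<le> H"
      by linarith
  qed
qed

text \<open>All widths are 1, so subset sums of widths are cardinalities, and the nine other items
  realize exactly 0 to 9.\<close>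

lemma normal_positions_a:
  assumes "j \<in> {1..10}"
  shows "normal_positions instance_a 1 j = {0..9}"
proof -
  have "\<exists>S\<subseteq>{1..10} - {j}. p = card S" if "p \<le> 9" for p
  proof -
    have "p \<le> card ({1..10} - {j})" using assms that by simp
    then show ?thesis by (metis obtain_subset_with_card_n)
  qed
  then show ?thesis
    unfolding normal_positions_def items_a
    by (auto simp: instance_a_def eligible_def)
qed

lemma covering_positions_a:
  assumes "j \<in> {1..10}" "q < 10"
  shows "covering_positions instance_a 1 j q = {q}"
  unfolding covering_positions_def normal_positions_a[OF assms(1)]
  using assms(2) by (auto simp: instance_a_def)

text \<open>The height constraint of the tall item alone forces the value 10; placing item \<open>j\<close> at
  position \<open>j - 1\<close> attains it.\<close>
lemma LP_PC_instance_a: "LP_PC instance_a = 10"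
  unfolding LP_PC_def
proof (rule Least_equality)
  let ?x = "\<lambda>(i::nat) j p. if p = j - 1 then 1 else 0 :: real"
  have total: "(\<Sum>p\<in>normal_positions instance_a 1 j. ?x 1 j p) = 1" if "j \<in> {1..10}" for j
    using that by (subst normal_positions_a[OF that]) auto
  have load: "(\<Sum>j\<in>{1..10}. \<Sum>p\<in>covering_positions instance_a 1 j q.
      real (item_height instance_a 1 j) * ?x 1 j p) \<le> 10" if "q < 10" for q
  proof -
    \<comment> \<open>Only position \<open>q\<close> of a unit-width item covers column
      \<open>q\<close>, and only item \<open>Suc q\<close> is placed there.\<close>
    have "(\<Sum>j\<in>{1..10}. \<Sum>p\<in>covering_positions instance_a 1 j q.
        real (item_height instance_a 1 j) * ?x 1 j p) =
        (\<Sum>j\<in>{1..10}. if j = Suc q then real (item_height instance_a 1 j) else 0)"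
      by (rule sum.cong) (use that in \<open>auto simp: covering_positions_a[simplified]\<close>)
    also have "\<dots> \<le> 10"
      by (simp add: instance_a_def)
    finally show ?thesis .
  qed
  have width: "strip_width instance_a 1 = 10"
    and height: "item_height instance_a 1 j \<le> 10" for j
    by (simp_all add: instance_a_def)
  have "lp_pc_feasible instance_a ?x (\<lambda>_. 10) 10"
    unfolding lp_pc_feasible_def items_a strips_a
    using total load width height by simp
  then show "\<exists>x H. lp_pc_feasible instance_a x H 10" by blast
next
  fix Hmax assume "\<exists>x H. lp_pc_feasible instance_a x H Hmax"
  then obtain x H where f: "lp_pc_feasible instance_a x H Hmax" by blast
  then have "(\<Sum>p\<in>normal_positions instance_a 1 1. x 1 1 p) = 1"
    by (simp add: lp_pc_feasible_def)
  moreover have "real (item_height instance_a 1 1) * (\<Sum>p\<in>normal_positions instance_a 1 1. x 1 1 p) \<le> H 1"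
    and "H 1 \<le> Hmax"
    using f unfolding lp_pc_feasible_def items_a strips_a by auto
  moreover have "item_height instance_a 1 1 = 10"
    by (simp add: instance_a_def)
  ultimately show "10 \<le> Hmax" by simp
qed

text \<open>One of the two binary variables must be 1, and the strip it selects then carries load 10
  * 10 / 10.\<close>

lemma Z_ms_instance_b: "Z_ms instance_b = 10"
  unfolding Z_ms_def
proof (rule Least_equality)
  have "sched_feasible instance_b (\<lambda>i _. if i = 1 then 1 else 0) 10"
    unfolding sched_feasible_def items_b strips_b
    by (simp add: sched_time_def eligible_def instance_b_def)
  then show "\<exists>v. sched_feasible instance_b v 10" by blast
next
  fix H assume "\<exists>v. sched_feasible instance_b v H"
  then obtain v where "sched_feasible instance_b v H" ..
  then show "10 \<le> H"
    unfolding sched_feasible_def items_b strips_b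
    by (auto simp: sched_time_def instance_b_def)
qed

lemma normal_positions_b: "normal_positions instance_b i 1 = {0}"
  unfolding normal_positions_def items_b by (auto simp: instance_b_def eligible_def)

lemma covering_positions_b: "q < 10 \<Longrightarrow> covering_positions instance_b i 1 q = {0}"
  unfolding covering_positions_def normal_positions_b by (auto simp: instance_b_def)

text \<open>The item fills the width, so 0 is its only position on either strip. Its two fractions
  sum to 1, so adding the item-height constraints of both strips yields 10 \<le> 2 *
  \<open>Hmax\<close>; equal halves attain this.\<close>

lemma LP_PC_instance_b: "LP_PC instance_b = 5"
  unfolding LP_PC_def
proof (rule Least_equality)
  have dims: "strip_width instance_b i = 10" "item_height instance_b i j = 10" for i j
    by (simp_all add: instance_b_def)
  have "lp_pc_feasible instance_b (\<lambda>_ _ _. 1 / 2) (\<lambda>_. 5) 5"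
    unfolding lp_pc_feasible_def items_b strips_b
    using dims by (simp add: normal_positions_b[simplified] covering_positions_b[simplified])
  then show "\<exists>x H. lp_pc_feasible instance_b x H 5" by blast
  fix Hmax assume "\<exists>x H. lp_pc_feasible instance_b x H Hmax"
  then obtain x H where "lp_pc_feasible instance_b x H Hmax" by blast
  then show "5 \<le> Hmax"
    unfolding lp_pc_feasible_def items_b strips_b
    using dims by (simp add: normal_positions_b[simplified])
qed

theorem mainTheorem4:
  "\<not> dominates Z_ms LP_PC \<and>
   \<not> dominates LP_PC Z_ms \<and>
   (Z_ms instance_a = 19 / 10 \<and> LP_PC instance_a \<ge> 10) \<and>
   (Z_ms instance_b = 10 \<and> LP_PC instance_b = 5)"
proof -
  have "\<not> dominates Z_ms LP_PC"
    unfolding dominates_def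
    using valid_instance_a Z_ms_instance_a LP_PC_instance_a by (auto intro!: exI[of _ instance_a])
  moreover have "\<not> dominates LP_PC Z_ms"
    unfolding dominates_def
    using valid_instance_b Z_ms_instance_b LP_PC_instance_b by (auto intro!: exI[of _ instance_b])
  ultimately show ?thesis
    using Z_ms_instance_a LP_PC_instance_a Z_ms_instance_b LP_PC_instance_b by simp
qed

end
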